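(* Let $X$ be a collapsible simplicial complex with collapse sequence $X=X_m\searrow X_{m-1}\searrow\cdots\searrow X_0=\{a\}$, $a\in X^0$, where $X_{j-1}=X_j\setminus\{\sigma_j,\tau_j\}$ with $\tau_j$ the free face of $\sigma_j$. Let $\mathrm{Co}:\bigoplus_{k\ge0}C_k(X)\to\bigoplus_{k\ge0}C_k(X)$ be the linear map defined inductively by $\mathrm{Co}(a)=0$ and, for $j=1,\dots,m$ (once $\mathrm{Co}$ is defined on chains of $X_{j-1}$), $$\mathrm{Co}(\sigma_j)=0,\qquad \mathrm{Co}(\tau_j)=\sigma_j-\mathrm{Co}(\partial\sigma_j-\tau_j).$$ Then $\mathrm{Co}$ is a simplicial cone operator with contraction vertex $a$; that is, $\mathrm{Co}$ maps $C_k(X)$ into $C_{k+1}(X)$, $\mathrm{Co}(\partial_k\sigma)+\partial_{k+1}\mathrm{Co}(\sigma)=\sigma$ for all $\sigma\in X^k$ with $k\ge1$, and $\partial_1\mathrm{Co}(v)=v-a$ for all $v\in X^0$.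
   Context: $X^k$ is the set of $k$-simplices of $X$, $C_k(X)$ the real vector space of simplicial $k$-chains, $\partial_k$ the boundary map, and $\partial$ denotes $\partial_k$ on $k$-chains. An elementary simplicial collapse $X\searrow X'$ is the passage from a simplicial complex $X$ to $X'=X\setminus\{\sigma,\tau\}$, where $\tau$ is a codimension-one face of $\sigma$ and $\sigma$ is the only simplex of $X$ other than $\tau$ itself having $\tau$ as a face; $\tau$ is called the free face. $X$ is collapsible if a finite sequence of elementary simplicial collapses reduces it to a single vertex. The free face $\tau_j$ is given the orientation with which it appears with coefficient $+1$ in $\partial\sigma_j$ (so that $\partial\sigma_j-\tau_j$ is a chain of $X_{j-1}$). *)

theory Defs
  imports "HOL-Analysis.Analysis" "HOL-Analysis.Finite_Function_Topology"
begin

section \<open>Simplicial complexes and elementary collapses\<close>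

text \<open>Complexes are abstract; the empty set is not a simplex.\<close>

definition abstract_simplicial_complex :: "'v set set \<Rightarrow> bool" where
  "abstract_simplicial_complex X \<longleftrightarrow>
     (\<forall>s\<in>X. finite s \<and> s \<noteq> {}) \<and> (\<forall>s\<in>X. \<forall>t. t \<subseteq> s \<and> t \<noteq> {} \<longrightarrow> t \<in> X)"

definition simplices :: "'v set set \<Rightarrow> nat \<Rightarrow> 'v set set" where
  "simplices X k = {s \<in> X. card s = k + 1}"

definition elementary_collapse :: "'v set set \<Rightarrow> 'v set \<Rightarrow> 'v set \<Rightarrow> 'v set set \<Rightarrow> bool" where
  "elementary_collapse X s t X' \<longleftrightarrow>
     s \<in> X \<and> t \<in> X \<and> t \<subseteq> s \<and> card s = card t + 1 \<and>
     (\<forall>r\<in>X. t \<subseteq> r \<longrightarrow> r = s \<or> r = t) \<and>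
     X' = X - {s, t}"


section \<open>Oriented simplicial chains\<close>

text \<open>An ordering of the vertices of a simplex, i.e. a distinct list, represents an oriented
  simplex. A chain is a finitely supported real function on oriented simplices which changes
  sign when the orientation is reversed, so it is determined by one value per simplex. The
  value at \<open>xs\<close> is the coefficient of the oriented simplex \<open>xs\<close> in the chain.\<close>

type_synonym 'v chain = "'v list \<Rightarrow>\<^sub>0 real"

definition chains :: "'v set set \<Rightarrow> nat \<Rightarrow> 'v chain set" where
  "chains X k = {c.
     (\<forall>xs \<in> Poly_Mapping.keys c. distinct xs \<and> set xs \<in> simplices X k) \<and>
     (\<forall>xs p. p permutes {..<length xs} \<longrightarrow>
        Poly_Mapping.lookup c (permute_list p xs) =
          of_int (sign p) * Poly_Mapping.lookup c xs)}"

text \<open>The (internal) direct sum of all chain spaces.\<close>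

definition total_chains :: "'v set set \<Rightarrow> 'v chain set" where
  "total_chains X = span (\<Union>k. chains X k)"

text \<open>The elementary chain of an oriented simplex: it is \<open>1\<close> on the even and \<open>-1\<close> on the odd
  reorderings of \<open>xs\<close>, and vanishes elsewhere.\<close>

definition oriented_simplex :: "'v list \<Rightarrow> 'v chain" where
  "oriented_simplex xs =
     (\<Sum>p | p permutes {..<length xs}.
        Poly_Mapping.single (permute_list p xs) (of_int (sign p)))"

definition delete_nth :: "nat \<Rightarrow> 'v list \<Rightarrow> 'v list" where
  "delete_nth i xs = take i xs @ drop (Suc i) xs"

text \<open>The usual alternating sum of faces; the boundary of a vertex is zero.\<close>

definition simplex_boundary :: "'v list \<Rightarrow> 'v chain" where
  "simplex_boundary xs =
     (if length xs \<le> 1 then 0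
      else \<Sum>i<length xs. (-1) ^ i *\<^sub>R oriented_simplex (delete_nth i xs))"

text \<open>The linear extension of \<^const>\<open>simplex_boundary\<close>. A \<open>k\<close>-simplex occurs in the support of
  a chain \<open>c\<close> through all \<open>(k+1)!\<close> orderings \<open>xs\<close> of its vertices, and all of them yield the
  same term \<open>c(xs)\<close> times the boundary of \<open>xs\<close>; hence the factorial. The law
  \<open>boundary_oriented_simplex\<close> below confirms the usual formula.\<close>

definition boundary :: "'v chain \<Rightarrow> 'v chain" where
  "boundary c =
     (\<Sum>xs\<in>Poly_Mapping.keys c.
        (Poly_Mapping.lookup c xs / fact (length xs)) *\<^sub>R simplex_boundary xs)"


section \<open>Simplicial cone operators\<close>

definition linear_map_between ::
    "'a::real_vector set \<Rightarrow> 'b::real_vector set \<Rightarrow> ('a \<Rightarrow> 'b) \<Rightarrow> bool" where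
  "linear_map_between S T f \<longleftrightarrow>
     (\<forall>x\<in>S. f x \<in> T) \<and>
     (\<forall>x\<in>S. \<forall>y\<in>S. f (x + y) = f x + f y) \<and>
     (\<forall>r. \<forall>x\<in>S. f (r *\<^sub>R x) = r *\<^sub>R f x)"

definition simplicial_cone_operator ::
    "'v set set \<Rightarrow> 'v \<Rightarrow> ('v chain \<Rightarrow> 'v chain) \<Rightarrow> bool" where
  "simplicial_cone_operator X a Co \<longleftrightarrow>
     {a} \<in> simplices X 0 \<and>
     linear_map_between (total_chains X) (total_chains X) Co \<and>
     (\<forall>k. \<forall>c \<in> chains X k. Co c \<in> chains X (k + 1)) \<and>
     (\<forall>k\<ge>1. \<forall>xs. distinct xs \<and> set xs \<in> simplices X k \<longrightarrow>
        Co (boundary (oriented_simplex xs)) + boundary (Co (oriented_simplex xs))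
          = oriented_simplex xs) \<and>
     (\<forall>v. {v} \<in> simplices X 0 \<longrightarrow>
        boundary (Co (oriented_simplex [v])) = oriented_simplex [v] - oriented_simplex [a])"


section \<open>Collapse sequences\<close>

text \<open>\<open>Xs m = X\<close> collapses in \<open>m\<close> elementary steps to \<open>Xs 0 = {{a}}\<close>; step \<open>j\<close> removes the
  simplices \<open>\<sigma> j\<close> and \<open>\<tau> j\<close>. Both are listed with an arbitrary ordering of their vertices.\<close>

definition collapse_sequence ::
    "'v set set \<Rightarrow> nat \<Rightarrow> (nat \<Rightarrow> 'v set set) \<Rightarrow> (nat \<Rightarrow> 'v list) \<Rightarrow> (nat \<Rightarrow> 'v list) \<Rightarrow> 'v \<Rightarrow> bool"
  where
  "collapse_sequence X m Xs \<sigma> \<tau> a \<longleftrightarrow>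
     Xs m = X \<and> Xs 0 = {{a}} \<and>
     (\<forall>j\<in>{1..m}. distinct (\<sigma> j) \<and> distinct (\<tau> j) \<and>
        elementary_collapse (Xs j) (set (\<sigma> j)) (set (\<tau> j)) (Xs (j - 1)))"

text \<open>For a codimension-one face \<open>ys\<close> of \<open>xs\<close>, the elementary chain of that face with the
  orientation with which it appears with coefficient \<open>+1\<close> in the boundary of \<open>xs\<close>. The coefficient
  of \<open>ys\<close> itself is \<open>1\<close> or \<open>-1\<close> (see \<open>lookup_boundary_face\<close> below), so this is \<open>ys\<close> or its
  reverse; if \<open>ys\<close> is a vertex \<open>[v]\<close>, it is \<open>v\<close> or \<open>-v\<close>.\<close>

definition induced_face :: "'v list \<Rightarrow> 'v list \<Rightarrow> 'v chain" where
  "induced_face xs ys =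
     Poly_Mapping.lookup (boundary (oriented_simplex xs)) ys *\<^sub>R oriented_simplex ys"


section \<open>The boundary of an oriented simplex\<close>

lemma lookup_scaleR_chain [simp]:
  "Poly_Mapping.lookup (r *\<^sub>R c) xs = r * Poly_Mapping.lookup (c :: 'v chain) xs"
proof -
  have "finite {x. r *\<^sub>R Poly_Mapping.lookup c x \<noteq> 0}"
    by (rule finite_subset[OF _ finite_lookup[of c]]) auto
  then show ?thesis by (simp add: scaleR_poly_mapping_def)
qed

lemma alternating_transpose:
  fixes f :: "'v list \<Rightarrow> 'b::real_vector"
  assumes adj: "\<And>xs i. Suc i < length xs \<Longrightarrow> f (permute_list (Transposition.transpose i (Suc i)) xs) = - f xs"
  shows "i < j \<Longrightarrow> j < length xs \<Longrightarrow> f (permute_list (Transposition.transpose i j) xs) = - f xs"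
proof (induction j arbitrary: xs)
  case 0
  then show ?case by simp
next
  case (Suc j)
  show ?case
  proof (cases "i = j")
    case True
    then show ?thesis using adj Suc.prems by simp
  next
    case False
    let ?n = "{..<length xs}"
    let ?s = "Transposition.transpose j (Suc j)" and ?t = "Transposition.transpose i j"
    have s: "?s permutes ?n" and t: "?t permutes ?n"
      using Suc.prems by (auto intro!: permutes_swap_id)
    have eq: "Transposition.transpose i (Suc j) = ?s \<circ> (?t \<circ> ?s)"
      using False Suc.prems by (auto simp: fun_eq_iff Transposition.transpose_def)
    have "permute_list (Transposition.transpose i (Suc j)) xs
        = permute_list ?s (permute_list ?t (permute_list ?s xs))"
      unfolding eq using s t
      by (simp add: permute_list_compose[of "?t \<circ> ?s"] permute_list_compose[of ?s]
          permutes_compose)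
    then show ?thesis
      using adj[of j] Suc.IH[of "permute_list ?s xs"] Suc.prems False by simp
  qed
qed

lemma alternating_permutes:
  fixes f :: "'v list \<Rightarrow> 'b::real_vector"
  assumes adj: "\<And>xs i. Suc i < length xs \<Longrightarrow> f (permute_list (Transposition.transpose i (Suc i)) xs) = - f xs"
    and p: "p permutes {..<length xs}"
  shows "f (permute_list p xs) = of_int (sign p) *\<^sub>R f xs"
proof -
  have "\<forall>xs. length xs = n \<longrightarrow> f (permute_list p xs) = of_int (sign p) *\<^sub>R f xs"
    if "p permutes {..<n}" for n
    using that
  proof (induction rule: permutes_induct[OF that finite_lessThan])
    case (1)
    then show ?case by simp
  next
    case (2 a b p)
    show ?case
    proof (intro allI impI)
      fix xs :: "'v list" assume len: "length xs = n"
      let ?t = "Transposition.transpose a b"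
      have flip: "f (permute_list ?t xs) = - f xs"
        using alternating_transpose[of f a b xs] alternating_transpose[of f b a xs] adj 2 len
        by (cases a b rule: linorder_cases) (auto simp: transpose_commute)
      have "permute_list (?t \<circ> p) xs = permute_list p (permute_list ?t xs)"
        using 2 len by (simp add: permute_list_compose)
      moreover have "sign (?t \<circ> p) = - sign p"
        using 2 by (simp add: sign_compose permutation_swap_id sign_swap_id
            permutes_imp_permutation[of "{..<n}"])
      ultimately show "f (permute_list (?t \<circ> p) xs) = of_int (sign (?t \<circ> p)) *\<^sub>R f xs"
        using 2 len flip by simp
    qed
  qed
  then show ?thesis using p by blast
qed

lemma oriented_simplex_permute:
  assumes q: "q permutes {..<length xs}"
  shows "oriented_simplex (permute_list q xs) = of_int (sign q) *\<^sub>R oriented_simplex xs"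
proof (rule poly_mapping_eqI)
  fix ys
  let ?P = "{p. p permutes {..<length xs}}"
  have "Poly_Mapping.lookup (oriented_simplex xs) ys
      = (\<Sum>p\<in>?P. of_int (sign (q \<circ> p)) when permute_list (q \<circ> p) xs = ys)"
    unfolding oriented_simplex_def lookup_sum lookup_single
    by (rule setum_permutations_compose_left[OF q])
  also have "\<dots> = (\<Sum>p\<in>?P. of_int (sign q) *
      (of_int (sign p) when permute_list p (permute_list q xs) = ys))"
    using q by (intro sum.cong refl)
      (auto simp: when_def permute_list_compose sign_compose permutes_imp_permutation[of "{..<length xs}"])
  also have "\<dots> = of_int (sign q) * Poly_Mapping.lookup (oriented_simplex (permute_list q xs)) ys"
    unfolding oriented_simplex_def lookup_sum lookup_single sum_distrib_left by simp
  finally show "Poly_Mapping.lookup (oriented_simplex (permute_list q xs)) ys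
      = Poly_Mapping.lookup (of_int (sign q) *\<^sub>R oriented_simplex xs) ys"
    by (cases q rule: sign_cases) auto
qed

lemma delete_nth_transpose:
  assumes i: "Suc i < length xs" and k: "k < length xs"
  defines "ys \<equiv> permute_list (Transposition.transpose i (Suc i)) xs"
  shows "k = i \<Longrightarrow> delete_nth k ys = delete_nth (Suc i) xs"
    and "k = Suc i \<Longrightarrow> delete_nth k ys = delete_nth i xs"
    and "k < i \<Longrightarrow> delete_nth k ys
           = permute_list (Transposition.transpose (i - 1) i) (delete_nth k xs)"
    and "Suc i < k \<Longrightarrow> delete_nth k ys
           = permute_list (Transposition.transpose i (Suc i)) (delete_nth k xs)"
  using i k unfolding ys_def delete_nth_def
  by (auto intro!: nth_equalityI
      simp: nth_append permute_list_def Transposition.transpose_def min_def less_Suc_eq)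

lemma length_delete_nth: "k < length xs \<Longrightarrow> length (delete_nth k xs) = length xs - 1"
  by (auto simp: delete_nth_def)

lemma simplex_boundary_transpose:
  assumes i: "Suc i < length xs"
  shows "simplex_boundary (permute_list (Transposition.transpose i (Suc i)) xs) = - simplex_boundary xs"
proof -
  let ?t = "Transposition.transpose i (Suc i)"
  let ?term = "\<lambda>xs k. (-1) ^ k *\<^sub>R oriented_simplex (delete_nth k xs)"
  have t: "?t permutes {..<length xs}" using i by (auto intro: permutes_swap_id)
  have step: "?term (permute_list ?t xs) k = - ?term xs (?t k)" if "k < length xs" for k
  proof -
    have s: "oriented_simplex (permute_list (Transposition.transpose j (Suc j)) ys)
        = - oriented_simplex ys" if "Suc j < length ys" for j :: nat and ys :: "'a list"
      using that
      by (subst oriented_simplex_permute) (auto simp: sign_swap_id intro!: permutes_swap_id)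
    consider "k = i" | "k = Suc i" | "k < i" | "Suc i < k" by linarith
    then show ?thesis
    proof cases
      case 1
      then show ?thesis using delete_nth_transpose(1)[OF i that] by simp
    next
      case 2
      then show ?thesis using delete_nth_transpose(2)[OF i that] by simp
    next
      case 3
      then show ?thesis
        using delete_nth_transpose(3)[OF i that] s[of "i - 1" "delete_nth k xs"] i that
        by (simp add: length_delete_nth Transposition.transpose_def)
    next
      case 4
      then show ?thesis
        using delete_nth_transpose(4)[OF i that] s[of i "delete_nth k xs"] i that
        by (simp add: length_delete_nth Transposition.transpose_def)
    qed
  qed
  have "(\<Sum>k<length xs. ?term (permute_list ?t xs) k) = (\<Sum>k<length xs. - ?term xs (?t k))"
    by (intro sum.cong) (use step in auto)
  also have "\<dots> = (\<Sum>k<length xs. - ?term xs k)"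
    using sum.permute[OF t, of "\<lambda>k. - ?term xs k"] by (simp add: o_def)
  finally show ?thesis
    using i by (simp add: simplex_boundary_def sum_negf)
qed

lemma linear_boundary: "linear boundary"
proof -
  let ?f = "\<lambda>xs x. (x / fact (length xs)) *\<^sub>R simplex_boundary xs"
  have eq: "boundary c = (\<Sum>xs\<in>S. ?f xs (Poly_Mapping.lookup c xs))"
    if "finite S" "Poly_Mapping.keys c \<subseteq> S" for S and c :: "'a chain"
    unfolding boundary_def using that
    by (intro sum.mono_neutral_left) (auto simp: in_keys_iff)
  show ?thesis
  proof (rule linearI)
    fix c d :: "'a chain" and r :: real
    show "boundary (c + d) = boundary c + boundary d"
    proof -
      let ?S = "Poly_Mapping.keys c \<union> Poly_Mapping.keys d"
      have "Poly_Mapping.keys (c + d) \<subseteq> ?S" by (rule keys_add)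
      then show ?thesis
        by (simp add: eq[of ?S] lookup_add add_divide_distrib scaleR_add_left sum.distrib)
    qed
    have "Poly_Mapping.keys (r *\<^sub>R c) \<subseteq> Poly_Mapping.keys c" by (auto simp: in_keys_iff)
    then show "boundary (r *\<^sub>R c) = r *\<^sub>R boundary c"
      by (simp add: eq[of "Poly_Mapping.keys c"] scaleR_sum_right)
  qed
qed

theorem boundary_oriented_simplex:
  "boundary (oriented_simplex xs) = simplex_boundary xs"
proof -
  let ?P = "{p. p permutes {..<length xs}}"
  have single: "boundary (Poly_Mapping.single ys r)
      = (r / fact (length ys)) *\<^sub>R simplex_boundary ys" for ys :: "'a list" and r
    by (cases "r = 0") (simp_all add: boundary_def)
  have "boundary (oriented_simplex xs)
      = (\<Sum>p\<in>?P. (of_int (sign p) / fact (length xs)) *\<^sub>R simplex_boundary (permute_list p xs))"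
    unfolding oriented_simplex_def by (simp add: linear_sum[OF linear_boundary] single)
  also have "\<dots> = (\<Sum>p\<in>?P. (1 / fact (length xs)) *\<^sub>R simplex_boundary xs)"
  proof (intro sum.cong refl)
    fix p assume "p \<in> ?P"
    then have "simplex_boundary (permute_list p xs) = of_int (sign p) *\<^sub>R simplex_boundary xs"
      using alternating_permutes[of simplex_boundary p xs] simplex_boundary_transpose by blast
    then show "(of_int (sign p) / fact (length xs)) *\<^sub>R simplex_boundary (permute_list p xs)
        = (1 / fact (length xs)) *\<^sub>R simplex_boundary xs"
      by (cases p rule: sign_cases) auto
  qed
  also have "\<dots> = simplex_boundary xs"
    by (simp add: sum_constant_scaleR card_permutations)
  finally show ?thesis .
qed


section \<open>Existence of the inductively defined map\<close>

lemma lookup_oriented_simplex_permute: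
  assumes q: "q permutes {..<length ys}"
  shows "Poly_Mapping.lookup (oriented_simplex xs) (permute_list q ys)
    = of_int (sign q) * Poly_Mapping.lookup (oriented_simplex xs) ys"
proof (cases "length xs = length ys")
  case False
  then have "permute_list p xs \<noteq> ys" "permute_list p xs \<noteq> permute_list q ys" for p
    by (metis length_permute_list)+
  then show ?thesis
    by (simp add: oriented_simplex_def lookup_sum lookup_single)
next
  case True
  let ?P = "{p. p permutes {..<length xs}}"
  have q': "q permutes {..<length xs}" using q True by simp
  have inj: "permute_list q us = permute_list q ys \<longleftrightarrow> us = ys" if "length us = length ys" for us
  proof -
    have "permute_list (inv q) (permute_list q us) = us" if "length us = length ys" for us :: "'a list"
      using q that by (subst permute_list_compose[symmetric])
        (auto simp: permutes_inv permutes_inv_o)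
    with that show ?thesis by metis
  qed
  have "Poly_Mapping.lookup (oriented_simplex xs) (permute_list q ys)
      = (\<Sum>p\<in>?P. of_int (sign (p \<circ> q)) when permute_list (p \<circ> q) xs = permute_list q ys)"
    unfolding oriented_simplex_def lookup_sum lookup_single
    by (rule sum_permutations_compose_right[OF q'])
  also have "\<dots> = (\<Sum>p\<in>?P. of_int (sign q) * (of_int (sign p) when permute_list p xs = ys))"
    using q' True by (intro sum.cong refl)
      (auto simp: when_def permute_list_compose sign_compose inj
        permutes_imp_permutation[of "{..<length xs}"])
  also have "\<dots> = of_int (sign q) * Poly_Mapping.lookup (oriented_simplex xs) ys"
    unfolding oriented_simplex_def lookup_sum lookup_single sum_distrib_left by simp
  finally show ?thesis .
qed

lemma lookup_oriented_simplex_nonzero: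
  assumes "Poly_Mapping.lookup (oriented_simplex xs) ys \<noteq> 0"
  shows "mset ys = mset xs"
proof -
  obtain p where "p permutes {..<length xs}" "permute_list p xs = ys"
    using assms unfolding oriented_simplex_def lookup_sum lookup_single
    by (auto elim!: sum.not_neutral_contains_not_neutral split: if_splits simp: when_def)
  then show ?thesis by auto
qed

lemma lookup_oriented_simplex_self:
  assumes "distinct xs"
  shows "Poly_Mapping.lookup (oriented_simplex xs) xs = 1"
proof -
  let ?P = "{p. p permutes {..<length xs}}"
  have "p = id" if p: "p permutes {..<length xs}" and eq: "permute_list p xs = xs" for p
  proof
    fix i
    show "p i = id i"
    proof (cases "i < length xs")
      case True
      then have "xs ! p i = xs ! i" using permute_list_nth[OF p] eq by metis
      moreover have "p i < length xs" using permutes_in_image[OF p] True by auto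
      ultimately show ?thesis using assms True by (simp add: nth_eq_iff_index_eq)
    next
      case False
      then show ?thesis using p by (auto simp: permutes_def)
    qed
  qed
  then have "Poly_Mapping.lookup (oriented_simplex xs) xs = (\<Sum>p\<in>?P. if p = id then 1 else 0)"
    unfolding oriented_simplex_def lookup_sum lookup_single
    by (intro sum.cong) (auto simp: when_def)
  also have "\<dots> = 1" by (simp add: finite_permutations permutes_id)
  finally show ?thesis .
qed

lemma oriented_simplex_in_chains:
  assumes "distinct xs" "set xs \<in> simplices X k"
  shows "oriented_simplex xs \<in> chains X k"
  unfolding chains_def
proof safe
  fix ys assume "ys \<in> Poly_Mapping.keys (oriented_simplex xs)"
  then have "mset ys = mset xs"
    by (simp add: in_keys_iff lookup_oriented_simplex_nonzero)
  then show "distinct ys" "set ys \<in> simplices X k"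
    using assms by (metis mset_eq_imp_distinct_iff, metis mset_eq_setD)
qed (rule lookup_oriented_simplex_permute)

lemma lookup_boundary_oriented_simplex_permute:
  assumes "q permutes {..<length ys}"
  shows "Poly_Mapping.lookup (boundary (oriented_simplex xs)) (permute_list q ys)
    = of_int (sign q) * Poly_Mapping.lookup (boundary (oriented_simplex xs)) ys"
  using lookup_oriented_simplex_permute[OF assms]
  by (simp add: boundary_oriented_simplex simplex_boundary_def lookup_sum sum_distrib_left mult_ac)

lemma lookup_boundary_oriented_simplex_nonzero:
  assumes "distinct xs" and "Poly_Mapping.lookup (boundary (oriented_simplex xs)) ys \<noteq> 0"
  shows "distinct ys \<and> set ys \<subset> set xs \<and> ys \<noteq> []"
proof -
  have len: "length xs > 1"
    using assms(2) by (auto simp: boundary_oriented_simplex simplex_boundary_def split: if_splits)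
  obtain i where i: "i < length xs"
      and "Poly_Mapping.lookup (oriented_simplex (delete_nth i xs)) ys \<noteq> 0"
    using assms(2) len
    by (auto simp: boundary_oriented_simplex simplex_boundary_def lookup_sum
        elim!: sum.not_neutral_contains_not_neutral)
  then have m: "mset ys = mset (delete_nth i xs)"
    using lookup_oriented_simplex_nonzero by blast
  have "xs = take i xs @ xs ! i # drop (Suc i) xs" using i by (rule id_take_nth_drop)
  then have ms: "mset xs = add_mset (xs ! i) (mset ys)"
    using m unfolding delete_nth_def by (metis mset.simps(2) mset_append union_mset_add_mset_right)
  then have d: "distinct (xs ! i # ys)"
    using assms(1) by (metis mset.simps(2) mset_eq_imp_distinct_iff)
  moreover have "set xs = insert (xs ! i) (set ys)"
    using ms by (metis list.simps(15) mset.simps(2) mset_eq_setD)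
  moreover have "length ys = length xs - 1"
    using ms by (metis add_diff_cancel_left' plus_1_eq_Suc size_add_mset size_mset)
  ultimately show ?thesis using len by auto
qed

lemma lookup_boundary_face:
  assumes xs: "distinct xs" and ys: "distinct ys" "ys \<noteq> []"
    and face: "set ys \<subseteq> set xs" "card (set xs) = card (set ys) + 1"
  shows "Poly_Mapping.lookup (boundary (oriented_simplex xs)) ys \<in> {1, -1}"
proof -
  have "card (set xs - set ys) = 1" using face by (simp add: card_Diff_subset)
  then obtain v where v: "set xs - set ys = {v}" by (rule card_1_singletonE)
  then obtain i where i: "i < length xs" "xs ! i = v" by (metis DiffD1 in_set_conv_nth singletonI)
  let ?d = "\<lambda>k. delete_nth k xs"
  have split: "mset xs = add_mset (xs ! k) (mset (?d k))" if "k < length xs" for k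
    unfolding delete_nth_def using id_take_nth_drop[OF that]
    by (metis mset.simps(2) mset_append union_mset_add_mset_right)
  have "Poly_Mapping.lookup (oriented_simplex (?d k)) ys = 0" if k: "k < length xs" "k \<noteq> i" for k
  proof (rule ccontr)
    assume "\<not> ?thesis"
    then have "mset ys = mset (?d k)" using lookup_oriented_simplex_nonzero by blast
    then have "mset xs = mset (xs ! k # ys)" using split[OF k(1)] by simp
    then have "distinct (xs ! k # ys)" using xs mset_eq_imp_distinct_iff by blast
    then have "xs ! k \<in> set xs - set ys" using k by simp
    then have "xs ! k = xs ! i" using v i by simp
    then show False using k i(1) nth_eq_iff_index_eq[OF xs] by blast
  qed
  then have zero: "(-1) ^ k * Poly_Mapping.lookup (oriented_simplex (?d k)) ys = 0"
    if "k \<in> {..<length xs} - {i}" for k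
    using that by simp
  have "mset xs = mset (v # ys)"
  proof -
    have "distinct (v # ys)" "set (v # ys) = set xs" using v ys face by auto
    then show ?thesis using xs by (metis set_eq_iff_mset_eq_distinct)
  qed
  then have m: "mset ys = mset (?d i)" using split[OF i(1)] i(2) by simp
  then have "distinct (?d i)" using ys mset_eq_imp_distinct_iff by blast
  moreover obtain p where "p permutes {..<length (?d i)}" "permute_list p (?d i) = ys"
    using m by (rule mset_eq_permutation)
  ultimately have val: "Poly_Mapping.lookup (oriented_simplex (?d i)) ys = of_int (sign p)"
    using lookup_oriented_simplex_permute[of p "?d i" "?d i"] lookup_oriented_simplex_self[of "?d i"]
    by simp
  have "length ys > 0" using ys by simp
  then have "length xs > 1" using ys face xs by (simp add: distinct_card)
  then have "Poly_Mapping.lookup (boundary (oriented_simplex xs)) ys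
      = (\<Sum>k<length xs. (-1) ^ k * Poly_Mapping.lookup (oriented_simplex (?d k)) ys)"
    by (simp add: boundary_oriented_simplex simplex_boundary_def lookup_sum)
  also have "\<dots> = (-1) ^ i * of_int (sign p)"
    using sum.mono_neutral_right[of "{..<length xs}" "{i}"
        "\<lambda>k. (-1) ^ k * Poly_Mapping.lookup (oriented_simplex (?d k)) ys"] zero i val
    by simp
  finally show ?thesis
    by (cases p rule: sign_cases; cases "even i") auto
qed

primrec collapse_cone ::
    "(nat \<Rightarrow> 'v list) \<Rightarrow> (nat \<Rightarrow> 'v list) \<Rightarrow> nat \<Rightarrow> 'v chain \<Rightarrow> 'v chain" where
  "collapse_cone \<sigma> \<tau> 0 c = 0"
| "collapse_cone \<sigma> \<tau> (Suc j) c =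
     (let s = oriented_simplex (\<sigma> (Suc j)); t = induced_face (\<sigma> (Suc j)) (\<tau> (Suc j));
          x = Poly_Mapping.lookup c (\<sigma> (Suc j));
          y = Poly_Mapping.lookup c (\<tau> (Suc j)) / Poly_Mapping.lookup t (\<tau> (Suc j))
      in collapse_cone \<sigma> \<tau> j (c - x *\<^sub>R s - y *\<^sub>R t)
           + y *\<^sub>R (s - collapse_cone \<sigma> \<tau> j (boundary s - t)))"

lemma linear_collapse_cone: "linear (collapse_cone \<sigma> \<tau> j)"
proof (induction j)
  case 0
  then show ?case by (simp add: linear_iff)
next
  case (Suc j)
  show ?case
    by (rule linearI)
      (simp_all add: Let_def lookup_add linear_add[OF Suc] linear_diff[OF Suc]
        linear_scale[OF Suc] add_divide_distrib scaleR_add_left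
        scaleR_add_right scaleR_diff_right)
qed

lemma abstract_simplicial_complex_collapse:
  assumes "abstract_simplicial_complex X" "elementary_collapse X s t X'"
  shows "abstract_simplicial_complex X'"
  unfolding abstract_simplicial_complex_def
proof (intro conjI ballI allI impI)
  note X = assms(1)[unfolded abstract_simplicial_complex_def]
  note c = assms(2)[unfolded elementary_collapse_def]
  fix r assume r: "r \<in> X'"
  then show "finite r" "r \<noteq> {}" using X c by blast+
  fix u assume u: "u \<subseteq> r \<and> u \<noteq> {}"
  have "r \<in> X" using c r by simp
  then have "u \<in> X" using X u by (meson order_trans)
  moreover have "\<not> t \<subseteq> r" using c r by blast
  then have "\<not> t \<subseteq> u" using u by blast
  then have "u \<noteq> s" "u \<noteq> t" using c by auto
  ultimately show "u \<in> X'" using c by simp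
qed

theorem collapse_cone_exists:
  assumes X: "abstract_simplicial_complex X"
    and seq: "collapse_sequence X m Xs \<sigma> \<tau> a"
  shows "\<exists>Co. linear_map_between (total_chains X) (total_chains X) Co \<and>
      Co (oriented_simplex [a]) = 0 \<and>
      (\<forall>j\<in>{1..m}. Co (oriented_simplex (\<sigma> j)) = 0 \<and>
         Co (induced_face (\<sigma> j) (\<tau> j)) = oriented_simplex (\<sigma> j)
           - Co (boundary (oriented_simplex (\<sigma> j)) - induced_face (\<sigma> j) (\<tau> j)))"
proof -
  let ?F = "collapse_cone \<sigma> \<tau>" and ?o = oriented_simplex
  let ?t = "\<lambda>j. induced_face (\<sigma> j) (\<tau> j)"
  let ?supp = "\<lambda>c Y. \<forall>xs. Poly_Mapping.lookup (c :: 'a chain) xs \<noteq> 0 \<longrightarrow> set xs \<in> Y"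
  have dist: "distinct (\<sigma> (Suc j))" "distinct (\<tau> (Suc j))"
    and coll: "elementary_collapse (Xs (Suc j)) (set (\<sigma> (Suc j))) (set (\<tau> (Suc j))) (Xs j)"
    if "j < m" for j
    using seq that unfolding collapse_sequence_def by (auto dest!: bspec[of _ _ "Suc j"])
  have in_X: "set (\<sigma> (Suc j)) \<in> Xs (Suc j)" "set (\<tau> (Suc j)) \<in> Xs (Suc j)"
    and card: "card (set (\<sigma> (Suc j))) = card (set (\<tau> (Suc j))) + 1"
    and del: "Xs j = Xs (Suc j) - {set (\<sigma> (Suc j)), set (\<tau> (Suc j))}"
    if "j < m" for j
    using coll[OF that] unfolding elementary_collapse_def by blast+
  have ends: "Xs m = X" "Xs 0 = {{a}}"
    using seq unfolding collapse_sequence_def by blast+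
  have cplx: "abstract_simplicial_complex (Xs j)" if "j \<le> m" for j
    using that
  proof (induction rule: inc_induct)
    case base
    then show ?case using X ends by simp
  next
    case (step n)
    then show ?case using abstract_simplicial_complex_collapse coll by blast
  qed
  have mono: "Xs i \<subseteq> Xs j" if "i \<le> j" "j \<le> m" for i j
    using that
  proof (induction rule: dec_induct)
    case (step n)
    then have "n < m" by simp
    from del[OF this] have "Xs n \<subseteq> Xs (Suc n)" by blast
    with step show ?case by simp
  qed auto
  have skip: "?F j c = ?F i c" if "i \<le> j" "j \<le> m" "?supp c (Xs i)" for i j c
    using that(1,2)
  proof (induction rule: dec_induct)
    case (step n)
    from step have "n < m" "Xs i \<subseteq> Xs n" using mono[of i n] by simp_all
    with del[of n] have "set (\<sigma> (Suc n)) \<notin> Xs i" "set (\<tau> (Suc n)) \<notin> Xs i"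
      by blast+
    then have "Poly_Mapping.lookup c (\<sigma> (Suc n)) = 0" "Poly_Mapping.lookup c (\<tau> (Suc n)) = 0"
      using that(3) by blast+
    then show ?case using step by simp
  qed auto
  have supp_o: "?supp (?o xs) Y" if "set xs \<in> Y" for xs Y
    using that lookup_oriented_simplex_nonzero mset_eq_setD by metis
  have supp_b: "?supp (boundary (?o (\<sigma> (Suc j))) - ?t (Suc j)) (Xs j)" if j: "j < m" for j
  proof (intro allI impI)
    fix xs
    let ?b = "boundary (?o (\<sigma> (Suc j)))" and ?t = "?t (Suc j)"
    assume nz: "Poly_Mapping.lookup (?b - ?t) xs \<noteq> 0"
    show "set xs \<in> Xs j"
    proof (cases "mset xs = mset (\<tau> (Suc j))")
      case True
      then obtain p where p: "p permutes {..<length (\<tau> (Suc j))}" "permute_list p (\<tau> (Suc j)) = xs"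
        by (rule mset_eq_permutation)
      have "Poly_Mapping.lookup (?b - ?t) xs = 0"
        using lookup_boundary_oriented_simplex_permute[OF p(1), of "\<sigma> (Suc j)"]
          lookup_oriented_simplex_permute[OF p(1), of "\<tau> (Suc j)"] p(2)
          lookup_oriented_simplex_self[OF dist(2)[OF j]]
        by (simp add: lookup_minus induced_face_def)
      with nz show ?thesis by simp
    next
      case False
      then have "Poly_Mapping.lookup ?t xs = 0"
        using lookup_oriented_simplex_nonzero by (auto simp: induced_face_def)
      then have "Poly_Mapping.lookup ?b xs \<noteq> 0" using nz by (simp add: lookup_minus)
      then have xs: "distinct xs" "set xs \<subset> set (\<sigma> (Suc j))" "xs \<noteq> []"
        using lookup_boundary_oriented_simplex_nonzero[OF dist(1)[OF j]] by blast+
      have "set xs \<noteq> set (\<tau> (Suc j))"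
        using False xs(1) dist(2)[OF j] by (simp add: set_eq_iff_mset_eq_distinct)
      moreover have "set xs \<in> Xs (Suc j)"
        using cplx[of "Suc j"] j in_X(1)[OF j] xs unfolding abstract_simplicial_complex_def
        by (metis Suc_leI psubset_imp_subset set_empty)
      ultimately show ?thesis unfolding del[OF j] using xs(2) by blast
    qed
  qed
  have range: "?F j c \<in> total_chains X" if "j \<le> m" for j c
    using that
  proof (induction j arbitrary: c)
    case 0
    then show ?case by (simp add: total_chains_def span_zero)
  next
    case (Suc j)
    have "set (\<sigma> (Suc j)) \<in> X"
      using in_X(1)[of j] mono[of "Suc j" m] Suc.prems unfolding ends by auto
    moreover from this have "card (set (\<sigma> (Suc j))) > 0"
      using X unfolding abstract_simplicial_complex_def card_gt_0_iff by blast
    ultimately have "set (\<sigma> (Suc j)) \<in> simplices X (card (set (\<sigma> (Suc j))) - 1)"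
      by (simp add: simplices_def)
    then have "?o (\<sigma> (Suc j)) \<in> chains X (card (set (\<sigma> (Suc j))) - 1)"
      using dist(1)[of j] Suc.prems by (intro oriented_simplex_in_chains) auto
    then have "?o (\<sigma> (Suc j)) \<in> total_chains X"
      unfolding total_chains_def by (intro span_base UN_I[OF UNIV_I])
    then show ?case
      using Suc by (simp add: Let_def total_chains_def span_add span_scale span_diff)
  qed
  have "linear_map_between (total_chains X) (total_chains X) (?F m)"
    using range[of m] linear_collapse_cone[of \<sigma> \<tau> m]
    by (simp add: linear_map_between_def linear_add linear_scale)
  moreover have "?F m (?o [a]) = 0"
    using skip[of 0 m "?o [a]"] supp_o[of "[a]" "Xs 0"] ends
    by simp
  moreover have "?F m (?o (\<sigma> j)) = 0 \<and> ?F m (?t j) = ?o (\<sigma> j) - ?F m (boundary (?o (\<sigma> j)) - ?t j)"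
    if "j \<in> {1..m}" for j
  proof -
    have "j = Suc (j - 1)" "j - 1 < m" using that by auto
    then obtain i where j: "j = Suc i" "i < m" by blast
    have ne: "set (\<sigma> j) \<noteq> set (\<tau> j)" using card[OF j(2)] j(1) by auto
    have z: "Poly_Mapping.lookup (?o (\<sigma> j)) (\<tau> j) = 0" "Poly_Mapping.lookup (?o (\<tau> j)) (\<sigma> j) = 0"
      using ne lookup_oriented_simplex_nonzero mset_eq_setD by metis+
    then have z': "Poly_Mapping.lookup (?t j) (\<sigma> j) = 0"
      by (simp add: induced_face_def)
    note one = lookup_oriented_simplex_self[OF dist(1)[OF j(2)]]
      lookup_oriented_simplex_self[OF dist(2)[OF j(2)]]
    have "\<tau> (Suc i) \<noteq> []"
      using in_X(2)[OF j(2)] cplx[of "Suc i"] j(2)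
      by (auto simp: abstract_simplicial_complex_def simp del: not_gr_zero)
    then have "Poly_Mapping.lookup (boundary (?o (\<sigma> j))) (\<tau> j) \<in> {1, -1}"
      unfolding j(1)
      using lookup_boundary_face[OF dist[OF j(2)]] coll[OF j(2)] card[OF j(2)]
      by (simp add: elementary_collapse_def)
    then have nz: "Poly_Mapping.lookup (?t j) (\<tau> j) \<noteq> 0"
      using one(2) unfolding j(1) by (auto simp: induced_face_def)
    note F0 = linear_0[OF linear_collapse_cone[of \<sigma> \<tau> i]]
    have "?supp (?t j) (Xs j)"
      using supp_o[OF in_X(2)[OF j(2)]] unfolding j(1) by (simp add: induced_face_def)
    then have "?F m (?o (\<sigma> j)) = ?F j (?o (\<sigma> j))" "?F m (?t j) = ?F j (?t j)"
      using skip[of j m, OF _ order_refl] supp_o[OF in_X(1)[OF j(2)]] j by simp_all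
    moreover have "?F j (?o (\<sigma> j)) = 0"
      "?F j (?t j) = ?o (\<sigma> j) - ?F i (boundary (?o (\<sigma> j)) - ?t j)"
      using z z' nz one F0 unfolding j(1) by (simp_all add: Let_def)
    moreover have "?F i (boundary (?o (\<sigma> j)) - ?t j) = ?F m (boundary (?o (\<sigma> j)) - ?t j)"
      using skip[of i m] supp_b[OF j(2)] j by simp
    ultimately show ?thesis by simp
  qed
  ultimately show ?thesis by blast
qed

end

theory Submission
  imports Defs
begin

text \<open>Write \<open>\<epsilon>\<close> for the augmentation, the sum of the coefficients of the vertices. Since
  \<open>\<partial>\<partial> = 0\<close> and \<open>\<epsilon>\<partial> = 0\<close>, both cone identities are instances of the single linear identity
  \<open>Co(\<partial>c) + \<partial>Co(c) = c - \<epsilon>(c) a\<close>. It is proved for the chains of \<open>X\<^sub>j\<close> by induction on \<open>j\<close>: for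
  \<open>\<sigma>\<^sub>j\<close> it is the defining equation of \<open>Co(\<tau>\<^sub>j)\<close>, and for \<open>\<tau>\<^sub>j\<close> it follows from the identity
  for the chain \<open>\<partial>\<sigma>\<^sub>j - \<tau>\<^sub>j\<close> of \<open>X\<^sub>j\<^sub>-\<^sub>1\<close>.\<close>

section \<open>Subspaces of chains and their generation by oriented simplices\<close>

lemma linear_map_between_0:
  assumes "linear_map_between S T f" "subspace S"
  shows "f 0 = 0"
  using assms(1) subspace_0[OF assms(2)] unfolding linear_map_between_def
  by (metis scaleR_zero_left)

text \<open>\<open>Co\<close> is assumed linear only on \<open>total_chains X\<close>, so preimages
  under it can be handled as subspaces only within that domain.\<close>

lemma subspace_linear_map_between_vimage:
  assumes "linear_map_between S T f" "subspace S" "subspace U"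
  shows "subspace {c \<in> S. f c \<in> U}"
proof (rule subspaceI)
  show "0 \<in> {c \<in> S. f c \<in> U}"
    using assms by (simp add: subspace_0 linear_map_between_0)
qed (use assms in \<open>auto simp: linear_map_between_def subspace_add subspace_scale\<close>)

lemma subspace_chains: "subspace (chains X k)"
proof (rule subspaceI)
  show "x + y \<in> chains X k" if "x \<in> chains X k" "y \<in> chains X k" for x y
    using that keys_add[of x y] by (fastforce simp: chains_def lookup_add distrib_left)
next
  show "r *\<^sub>R x \<in> chains X k" if "x \<in> chains X k" for r x
    using that by (auto simp: chains_def in_keys_iff)
qed (simp add: chains_def)

lemma subspace_total_chains: "subspace (total_chains X)"
  by (simp add: total_chains_def)

lemma chains_subset_total_chains: "chains X k \<subseteq> total_chains X"
  unfolding total_chains_def by (meson UN_upper UNIV_I span_superset subset_trans)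

lemma chains_mono: "Y \<subseteq> X \<Longrightarrow> chains Y k \<subseteq> chains X k"
  unfolding chains_def simplices_def by blast

text \<open>Induction on the size of the support. Subtracting c(xs) times the elementary chain of
  \<open>xs\<close> clears all orderings of that simplex at once, because both chains alternate, and
  changes no other coefficient, so the support shrinks strictly.\<close>

lemma chains_subset_span:
  "chains X k \<subseteq> span (oriented_simplex ` {xs. distinct xs \<and> set xs \<in> simplices X k})"
proof
  let ?B = "oriented_simplex ` {xs. distinct xs \<and> set xs \<in> simplices X k}"
  show "c \<in> span ?B" if "c \<in> chains X k" for c
    using that
  proof (induction "card (Poly_Mapping.keys c)" arbitrary: c rule: less_induct)
    case less
    show ?case
    proof (cases "c = 0")
      case True
      then show ?thesis by (simp add: span_zero)
    next
      case False
      then obtain xs where xs: "xs \<in> Poly_Mapping.keys c" by (metis keys_eq_empty ex_in_conv)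
      then have d: "distinct xs" "set xs \<in> simplices X k"
        using less.prems by (auto simp: chains_def)
      let ?r = "Poly_Mapping.lookup c xs *\<^sub>R oriented_simplex xs"
      have zero: "Poly_Mapping.lookup (c - ?r) ys = 0" if ys: "mset ys = mset xs" for ys
      proof -
        obtain p where p: "p permutes {..<length xs}" "permute_list p xs = ys"
          using ys by (rule mset_eq_permutation)
        then show ?thesis
          using less.prems lookup_oriented_simplex_permute[OF p(1), of xs]
            lookup_oriented_simplex_self[OF d(1)]
          by (auto simp: chains_def lookup_minus)
      qed
      have "Poly_Mapping.lookup (c - ?r) ys = Poly_Mapping.lookup c ys" if "mset ys \<noteq> mset xs" for ys
        using that lookup_oriented_simplex_nonzero[of xs ys] by (auto simp: lookup_minus)
      with zero have "Poly_Mapping.keys (c - ?r) \<subseteq> Poly_Mapping.keys c - {xs}"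
        unfolding in_keys_iff subset_iff by (metis Diff_iff in_keys_iff singletonD)
      then have "Poly_Mapping.keys (c - ?r) \<subset> Poly_Mapping.keys c" using xs by blast
      then have "card (Poly_Mapping.keys (c - ?r)) < card (Poly_Mapping.keys c)"
        by (simp add: psubset_card_mono)
      moreover have "c - ?r \<in> chains X k"
        using less.prems oriented_simplex_in_chains[OF d]
        by (intro subspace_diff subspace_scale subspace_chains)
      ultimately have "c - ?r \<in> span ?B" using less.hyps by blast
      moreover have "?r \<in> span ?B" using d by (intro span_scale span_base) auto
      ultimately have "(c - ?r) + ?r \<in> span ?B" by (rule span_add)
      then show ?thesis by simp
    qed
  qed
qed

text \<open>The form in which linear statements about chains are reduced to generators
  below.\<close>

lemma chains_subset_subspace:
  assumes "subspace U"
    and "\<And>xs. distinct xs \<Longrightarrow> set xs \<in> simplices X k \<Longrightarrow> oriented_simplex xs \<in> U"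
  shows "chains X k \<subseteq> U"
proof -
  have "oriented_simplex ` {xs. distinct xs \<and> set xs \<in> simplices X k} \<subseteq> U"
    using assms(2) by auto
  from span_minimal[OF this assms(1)] chains_subset_span[of X k] show ?thesis
    by (rule subset_trans[rotated])
qed

section \<open>The augmentation\<close>

text \<open>A vertex has only one ordering, so no factorial is divided out here, unlike in
  \<open>boundary\<close>.\<close>

definition augmentation :: "'v chain \<Rightarrow> real" where
  "augmentation c = (\<Sum>xs\<in>Poly_Mapping.keys c. if length xs = 1 then Poly_Mapping.lookup c xs else 0)"

lemma linear_augmentation: "linear augmentation"
proof -
  let ?f = "\<lambda>(xs :: 'a list) (x :: real). if length xs = 1 then x else 0"
  have eq: "augmentation c = (\<Sum>xs\<in>S. ?f xs (Poly_Mapping.lookup c xs))"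
    if "finite S" "Poly_Mapping.keys c \<subseteq> S" for S and c :: "'a chain"
    unfolding augmentation_def using that
    by (intro sum.mono_neutral_left) (auto simp: in_keys_iff)
  show ?thesis
  proof (rule linearI)
    fix c d :: "'a chain" and r :: real
    let ?S = "Poly_Mapping.keys c \<union> Poly_Mapping.keys d"
    have "Poly_Mapping.keys (c + d) \<subseteq> ?S" by (rule keys_add)
    then show "augmentation (c + d) = augmentation c + augmentation d"
      unfolding sum.distrib[symmetric] eq[of ?S c, simplified] eq[of ?S d, simplified]
      by (subst eq[of ?S]) (auto simp: lookup_add sum.distrib[symmetric] intro!: sum.cong)
    have "Poly_Mapping.keys (r *\<^sub>R c) \<subseteq> Poly_Mapping.keys c" by (auto simp: in_keys_iff)
    then show "augmentation (r *\<^sub>R c) = r *\<^sub>R augmentation c"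
      by (subst (1 2) eq[of "Poly_Mapping.keys c"]) (auto simp: sum_distrib_left intro!: sum.cong)
  qed
qed

lemma augmentation_oriented_simplex_vertex: "augmentation (oriented_simplex [v]) = 1"
proof -
  have "{p. p permutes {..<Suc 0}} = {id}"
    by (auto simp: lessThan_Suc permutes_sing)
  then have "oriented_simplex [v] = Poly_Mapping.single [v] 1"
    by (simp add: oriented_simplex_def)
  then show ?thesis by (simp add: augmentation_def)
qed

lemma augmentation_oriented_simplex_long:
  assumes "length xs \<noteq> 1"
  shows "augmentation (oriented_simplex xs) = 0"
  unfolding augmentation_def
proof (intro sum.neutral ballI)
  fix ys assume "ys \<in> Poly_Mapping.keys (oriented_simplex xs)"
  then have "length ys = length xs"
    by (metis in_keys_iff lookup_oriented_simplex_nonzero mset_eq_length)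
  with assms show "(if length ys = 1 then Poly_Mapping.lookup (oriented_simplex xs) ys else 0) = 0"
    by simp
qed

text \<open>Only an edge has vertices as faces, and there the two endpoints carry opposite signs.
  From three vertices on, all faces have at least two vertices and augmentation zero.\<close>

lemma augmentation_simplex_boundary: "augmentation (simplex_boundary xs) = 0"
proof -
  consider "length xs \<le> 1" | "length xs = 2" | "length xs > 2" by linarith
  then show ?thesis
  proof cases
    case 1
    then show ?thesis by (simp add: simplex_boundary_def linear_0[OF linear_augmentation])
  next
    case 2
    then obtain u v where "xs = [u, v]"
      by (auto simp: numeral_2_eq_2 length_Suc_conv)
    then show ?thesis
      by (simp add: simplex_boundary_def delete_nth_def lessThan_Suc linear_diff[OF linear_augmentation]
          augmentation_oriented_simplex_vertex)
  next
    case 3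
    then have "augmentation (oriented_simplex (delete_nth i xs)) = 0" if "i < length xs" for i
      using that by (intro augmentation_oriented_simplex_long) (simp add: length_delete_nth)
    then show ?thesis
      by (simp add: simplex_boundary_def linear_sum[OF linear_augmentation]
          linear_scale[OF linear_augmentation] linear_0[OF linear_augmentation])
  qed
qed

section \<open>The boundary of a boundary vanishes\<close>

lemma nth_delete_nth:
  assumes "i < length xs" "k < length xs - 1"
  shows "delete_nth i xs ! k = xs ! (if k < i then k else Suc k)"
  using assms by (auto simp: delete_nth_def nth_append)

text \<open>The simplicial identity for face maps: once the earlier position j is gone, the entry
  formerly at i sits at i - 1.\<close>

lemma delete_nth_delete_nth:
  assumes "j < i" "i < length xs"
  shows "delete_nth j (delete_nth i xs) = delete_nth (i - 1) (delete_nth j xs)"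
proof (rule nth_equalityI)
  show "length (delete_nth j (delete_nth i xs)) = length (delete_nth (i - 1) (delete_nth j xs))"
    using assms by (simp add: length_delete_nth)
next
  fix k assume "k < length (delete_nth j (delete_nth i xs))"
  then have k: "k < length xs - 2" using assms by (simp add: length_delete_nth)
  \<comment> \<open>Both lists are compared with a common normal form, \<open>xs\<close> with the
    positions j and i skipped.\<close>
  have "delete_nth j (delete_nth i xs) ! k
      = xs ! (if k < j then k else if Suc k < i then Suc k else Suc (Suc k))"
    using assms k by (simp add: nth_delete_nth length_delete_nth)
  moreover have "delete_nth (i - 1) (delete_nth j xs) ! k
      = xs ! (if k < j then k else if Suc k < i then Suc k else Suc (Suc k))"
    using assms k by (simp add: nth_delete_nth length_delete_nth less_diff_conv)
  ultimately show "delete_nth j (delete_nth i xs) ! k = delete_nth (i - 1) (delete_nth j xs) ! k"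
    by simp
qed

lemma boundary_simplex_boundary: "boundary (simplex_boundary xs) = 0"
proof (cases "length xs \<le> 2")
  \<comment> \<open>Each face has at most one vertex here, and its boundary is zero by convention
    rather than by the alternating sum.\<close>
  case True
  have "simplex_boundary (delete_nth i xs) = 0" if "i < length xs" for i
    using True that by (simp add: simplex_boundary_def length_delete_nth)
  then show ?thesis
    by (simp add: simplex_boundary_def[of xs] linear_sum[OF linear_boundary]
        linear_scale[OF linear_boundary] linear_0[OF linear_boundary] boundary_oriented_simplex)
next
  case False
  let ?n = "length xs"
  \<comment> \<open>Position i is deleted first and j counts positions in the shortened list, which
    is why the second range of \<open>?A\<close> stops at \<open>?n - 1\<close>.\<close>
  let ?g = "\<lambda>(i, j). (-1) ^ (i + j) *\<^sub>R oriented_simplex (delete_nth j (delete_nth i xs))"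
  let ?A = "{..<?n} \<times> {..<?n - 1}"
  let ?L = "{(i, j) \<in> ?A. j < i}" and ?U = "{(i, j) \<in> ?A. i \<le> j}"
  have "boundary (simplex_boundary xs)
      = (\<Sum>i<?n. (-1) ^ i *\<^sub>R simplex_boundary (delete_nth i xs))"
    using False by (simp add: simplex_boundary_def[of xs] linear_sum[OF linear_boundary]
        linear_scale[OF linear_boundary] boundary_oriented_simplex)
  also have "\<dots> = (\<Sum>i<?n. \<Sum>j<?n - 1. ?g (i, j))"
    using False by (intro sum.cong refl)
      (auto simp: simplex_boundary_def length_delete_nth scaleR_sum_right power_add)
  also have "\<dots> = sum ?g ?A"
    by (simp add: sum.cartesian_product)
  also have "\<dots> = sum ?g (?L \<union> ?U)"
    by (intro arg_cong[where f = "sum ?g"]) auto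
  also have "\<dots> = sum ?g ?L + sum ?g ?U"
    by (rule sum.union_disjoint) (auto intro: finite_subset[of _ ?A])
  \<comment> \<open>The pairs (i, j) with j < i and (j, i - 1) delete the same two entries, by the
    simplicial identity, and their exponents differ by one. So the two halves of the sum
    cancel.\<close>
  also have "sum ?g ?L = (\<Sum>x\<in>?U. - ?g x)"
  proof (rule sum.reindex_bij_witness[where i = "\<lambda>(i, j). (Suc j, i)" and j = "\<lambda>(i, j). (j, i - 1)"])
    fix x assume "x \<in> ?L"
    then obtain i j where x: "x = (i, j)" "j < i" "i < ?n" by auto
    then have "(-1) ^ (i + j) = - ((-1) ^ (j + (i - 1)) :: real)"
      by (cases i) (simp_all add: add.commute)
    then show "- ?g (case x of (i, j) \<Rightarrow> (j, i - 1)) = ?g x"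
      using x delete_nth_delete_nth[of j i xs] by simp
  qed auto
  finally show ?thesis by (simp add: sum_negf)
qed

section \<open>Boundaries within a complex and across a collapse\<close>

lemma simplex_boundary_in_chains:
  assumes X: "abstract_simplicial_complex X"
    and xs: "distinct xs" "set xs \<in> X" "length xs = Suc (Suc k)"
  shows "simplex_boundary xs \<in> chains X k"
proof -
  have "oriented_simplex (delete_nth i xs) \<in> chains X k" if i: "i < length xs" for i
  proof (rule oriented_simplex_in_chains)
    have "xs = take i xs @ xs ! i # drop (Suc i) xs" using i by (rule id_take_nth_drop)
    then show d: "distinct (delete_nth i xs)"
      unfolding delete_nth_def using xs(1) by (metis distinct.simps(2) distinct_append
        distinct_append disjoint_insert(1) list.simps(15))
    have len: "length (delete_nth i xs) = Suc k" using i xs(3) by (simp add: length_delete_nth)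
    have "set (delete_nth i xs) \<subseteq> set xs"
      using set_take_subset[of i xs] set_drop_subset[of "Suc i" xs] by (auto simp: delete_nth_def)
    moreover have "set (delete_nth i xs) \<noteq> {}" using len by auto
    ultimately have "set (delete_nth i xs) \<in> X"
      using X xs(2) unfolding abstract_simplicial_complex_def by blast
    then show "set (delete_nth i xs) \<in> simplices X k"
      using distinct_card[OF d] len by (simp add: simplices_def)
  qed
  then show ?thesis
    using xs(3) unfolding simplex_boundary_def
    by (auto simp del: sum.lessThan_Suc intro!: subspace_sum subspace_scale subspace_chains)
qed

text \<open>Since \<open>Co\<close> is linear only on the chains of X, Co(\<partial>c) depends
  linearly on c only because \<partial>c stays among those chains.\<close>

lemma boundary_in_total_chains:
  assumes X: "abstract_simplicial_complex X" and c: "c \<in> total_chains X"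
  shows "boundary c \<in> total_chains X"
proof -
  let ?U = "{c. boundary c \<in> total_chains X}"
  have U: "subspace ?U"
    using linear_subspace_vimage[OF linear_boundary subspace_total_chains] by (simp add: vimage_def)
  have "chains X k \<subseteq> ?U" for k
  proof (rule chains_subset_subspace[OF U])
    fix xs assume xs: "distinct xs" "set xs \<in> simplices X k"
    then have len: "length xs = Suc k" by (simp add: simplices_def distinct_card)
    have "simplex_boundary xs \<in> total_chains X"
    proof (cases k)
      case 0
      then show ?thesis
        using len by (simp add: simplex_boundary_def subspace_0[OF subspace_total_chains])
    next
      case (Suc l)
      then show ?thesis
        using simplex_boundary_in_chains[OF X xs(1), of l] chains_subset_total_chains xs(2) len
        by (auto simp: simplices_def)
    qed
    then show "oriented_simplex xs \<in> ?U" by (simp add: boundary_oriented_simplex)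
  qed
  then have "(\<Union>k. chains X k) \<subseteq> ?U" by blast
  then have "total_chains X \<subseteq> ?U"
    using span_minimal[OF _ U] by (simp only: total_chains_def[of X])
  with c show ?thesis by blast
qed

text \<open>This is what makes the recursive clause for the free face meaningful. The factor in
  \<open>induced_face\<close> is chosen so that the difference vanishes at \<open>ys\<close>;
  alternation extends this to every ordering of the free face. The simplex \<open>xs\<close> itself
  is excluded by its dimension.\<close>

lemma boundary_minus_induced_face_in_chains:
  assumes X: "abstract_simplicial_complex X"
    and c: "elementary_collapse X (set xs) (set ys) X'"
    and d: "distinct xs" "distinct ys"
    and len: "length ys = Suc k"
  shows "boundary (oriented_simplex xs) - induced_face xs ys \<in> chains X' k"
proof -
  let ?r = "boundary (oriented_simplex xs) - induced_face xs ys"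
  have c': "set xs \<in> X" "set ys \<in> X" "length xs = Suc (Suc k)" "X' = X - {set xs, set ys}"
    using c d len by (auto simp: elementary_collapse_def distinct_card)
  have "oriented_simplex ys \<in> chains X k"
    using c' d len by (intro oriented_simplex_in_chains) (auto simp: simplices_def distinct_card)
  then have r: "?r \<in> chains X k"
    using simplex_boundary_in_chains[OF X d(1) c'(1,3)]
    by (auto simp: induced_face_def boundary_oriented_simplex
        intro!: subspace_diff subspace_scale subspace_chains)
  have "set zs \<in> simplices X' k" if zs: "zs \<in> Poly_Mapping.keys ?r" for zs
  proof -
    have z: "distinct zs" "set zs \<in> simplices X k" using r zs by (auto simp: chains_def)
    have "set zs \<noteq> set ys"
    proof
      assume "set zs = set ys"
      then have "mset zs = mset ys" using z d by (simp add: set_eq_iff_mset_eq_distinct)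
      then obtain p where p: "p permutes {..<length ys}" "permute_list p ys = zs"
        by (rule mset_eq_permutation)
      have "Poly_Mapping.lookup ?r ys = 0"
        using lookup_oriented_simplex_self[OF d(2)] by (simp add: lookup_minus induced_face_def)
      then have "Poly_Mapping.lookup ?r zs = 0"
        using r p by (auto simp: chains_def)
      with zs show False by (simp add: in_keys_iff)
    qed
    moreover have "set zs \<noteq> set xs"
      using z c'(3) d by (metis (mono_tags, lifting) simplices_def mem_Collect_eq distinct_card
        Suc_eq_plus1 n_not_Suc_n)
    ultimately show ?thesis using z c'(4) by (simp add: simplices_def)
  qed
  with r show ?thesis by (simp add: chains_def)
qed

section \<open>The subspace on which the cone identity holds\<close>

text \<open>The degree condition and the identity are bundled so that one induction proves both. X
  stays the whole complex throughout, since \<open>Co\<close> is linear on its chains; the stages of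
  the collapse enter only as the chains shown to lie in this set. The index k fixes only the degree
  of the image.\<close>

definition contracting :: "'v set set \<Rightarrow> 'v \<Rightarrow> ('v chain \<Rightarrow> 'v chain) \<Rightarrow> nat \<Rightarrow> 'v chain set" where
  "contracting X a Co k = {c \<in> total_chains X. Co c \<in> chains X (Suc k) \<and>
     Co (boundary c) + boundary (Co c) = c - augmentation c *\<^sub>R oriented_simplex [a]}"

lemma subspace_contracting:
  assumes X: "abstract_simplicial_complex X" "{a} \<in> X"
    and Co: "linear_map_between (total_chains X) (total_chains X) Co"
  shows "subspace (contracting X a Co k)"
proof -
  let ?T = "total_chains X" and ?a = "oriented_simplex [a]"
  \<comment> \<open>The defect of the cone identity is itself linear on the total chains, so the
    identity holds exactly on its kernel.\<close>
  let ?h = "\<lambda>c. Co (boundary c) + boundary (Co c) - (c - augmentation c *\<^sub>R ?a)"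
  have a: "?a \<in> ?T"
    using oriented_simplex_in_chains[of "[a]" X 0] chains_subset_total_chains X
    by (auto simp: simplices_def)
  have "linear_map_between ?T ?T ?h"
    using Co a unfolding linear_map_between_def
    by (auto simp: boundary_in_total_chains[OF X(1)] linear_add[OF linear_boundary]
        linear_scale[OF linear_boundary] linear_add[OF linear_augmentation]
        linear_scale[OF linear_augmentation] algebra_simps
        intro!: subspace_add subspace_diff subspace_scale subspace_total_chains)
  then have "subspace {c \<in> ?T. ?h c \<in> {0}}"
    by (rule subspace_linear_map_between_vimage[OF _ subspace_total_chains subspace_single_0])
  moreover have "subspace {c \<in> ?T. Co c \<in> chains X (Suc k)}"
    by (rule subspace_linear_map_between_vimage[OF Co subspace_total_chains subspace_chains])
  ultimately have "subspace ({c \<in> ?T. Co c \<in> chains X (Suc k)} \<inter> {c \<in> ?T. ?h c \<in> {0}})"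
    by (rule subspace_inter[rotated])
  also have "{c \<in> ?T. Co c \<in> chains X (Suc k)} \<inter> {c \<in> ?T. ?h c \<in> {0}} = contracting X a Co k"
    by (auto simp: contracting_def)
  finally show ?thesis .
qed

text \<open>A collapse step names one ordering of each removed simplex. Any other ordering changes
  the elementary chain by a sign, which a subspace absorbs.\<close>

lemma contracting_reorder:
  assumes "subspace (contracting X a Co k)" "oriented_simplex ys \<in> contracting X a Co k"
    and "distinct xs" "distinct ys" "set xs = set ys"
  shows "oriented_simplex xs \<in> contracting X a Co k"
proof -
  have "mset xs = mset ys" using assms by (simp add: set_eq_iff_mset_eq_distinct)
  then obtain p where p: "p permutes {..<length ys}" "permute_list p ys = xs"
    by (rule mset_eq_permutation)
  then show ?thesis
    using oriented_simplex_permute[OF p(1)] subspace_scale[OF assms(1,2)] by simp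
qed

text \<open>The inductive step: beyond the generators of \<open>Y'\<close> only the two removed
  simplices have to be checked, first \<open>xs\<close> and then its free face.\<close>

lemma contracting_collapse:
  assumes X: "abstract_simplicial_complex X" "{a} \<in> X"
    and Co: "linear_map_between (total_chains X) (total_chains X) Co"
    and Y: "abstract_simplicial_complex Y" "Y \<subseteq> X"
    and c: "elementary_collapse Y (set xs) (set ys) Y'"
    and d: "distinct xs" "distinct ys"
    and Co_xs: "Co (oriented_simplex xs) = 0"
    and Co_ys: "Co (induced_face xs ys) =
      oriented_simplex xs - Co (boundary (oriented_simplex xs) - induced_face xs ys)"
    and IH: "\<And>k. chains Y' k \<subseteq> contracting X a Co k"
  shows "chains Y k \<subseteq> contracting X a Co k"
proof -
  let ?s = "oriented_simplex xs" and ?t = "induced_face xs ys"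
  let ?r = "boundary ?s - ?t" and ?a = "oriented_simplex [a]"
  note W = subspace_contracting[OF X Co]
  have c': "set xs \<in> Y" "set ys \<in> Y" "set ys \<subseteq> set xs" "length xs = Suc (length ys)"
      "card (set xs) = card (set ys) + 1" "Y' = Y - {set xs, set ys}"
    using c d by (auto simp: elementary_collapse_def distinct_card)
  have ne: "ys \<noteq> []" using c'(2) Y(1) by (auto simp: abstract_simplicial_complex_def)
  then obtain l where l: "length ys = Suc l" by (metis length_Suc_conv neq_Nil_conv)
  have s: "?s \<in> chains X (Suc l)" and y: "oriented_simplex ys \<in> chains X l"
    using c' d l Y(2) by (auto intro!: oriented_simplex_in_chains simp: simplices_def distinct_card)
  have t: "?t \<in> chains X l"
    using y by (simp add: induced_face_def subspace_scale[OF subspace_chains])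
  have rY: "?r \<in> chains Y' l"
    by (rule boundary_minus_induced_face_in_chains[OF Y(1) c d l])
  have "Y' \<subseteq> X" using Y(2) c'(6) by blast
  then have rX: "?r \<in> chains X l" using rY chains_mono by blast
  have r: "?r \<in> contracting X a Co l" using IH rY by blast
  note T = subsetD[OF chains_subset_total_chains[of X]]
  have add: "Co (u + v) = Co u + Co v" if "u \<in> total_chains X" "v \<in> total_chains X" for u v
    using Co that by (simp add: linear_map_between_def)
  \<comment> \<open>As \<partial>s = t + r, this is the prescribed value of Co(t) with Co(r) moved
    to the other side.\<close>
  have Co_b: "Co (boundary ?s) = ?s"
    using add[OF T[OF t] T[OF rX]] Co_ys by simp
  have dd: "boundary (boundary ?s) = 0"
    by (simp add: boundary_oriented_simplex boundary_simplex_boundary)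
  \<comment> \<open>Even if the free face is a vertex, \<open>xs\<close> has at least two vertices,
    so no multiple of a appears.\<close>
  have "augmentation ?s = 0"
    using l c'(4) by (intro augmentation_oriented_simplex_long) simp
  then have s_in: "?s \<in> contracting X a Co (Suc l)"
    using Co_xs Co_b T[OF s]
    by (simp add: contracting_def linear_0[OF linear_boundary] subspace_0[OF subspace_chains])
  have "Co ?t \<in> chains X (Suc l)"
    using Co_ys s r by (auto simp: contracting_def intro!: subspace_diff subspace_chains)
  \<comment> \<open>Apply \<partial> to Co(t) = s - Co(r) and replace \<partial>Co(r) by r -
    \<epsilon>(r)a - Co(\<partial>r). Here \<partial>r = -\<partial>t and \<epsilon>(r) =
    -\<epsilon>(t), because \<partial>\<partial>s = 0 and \<epsilon>(\<partial>s) = 0.\<close>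
  moreover have "Co (boundary ?t) + boundary (Co ?t) = ?t - augmentation ?t *\<^sub>R ?a"
  proof -
    have bt: "boundary ?r = - boundary ?t"
      using dd by (simp add: linear_diff[OF linear_boundary])
    have "augmentation ?r = - augmentation ?t"
      by (simp add: linear_diff[OF linear_augmentation] boundary_oriented_simplex
          augmentation_simplex_boundary)
    moreover have "Co (- boundary ?t) = - Co (boundary ?t)"
      using Co boundary_in_total_chains[OF X(1) T[OF t]] unfolding linear_map_between_def
      by (metis scaleR_minus1_left)
    ultimately have "boundary (Co ?r) = ?r + augmentation ?t *\<^sub>R ?a + Co (boundary ?t)"
      using r bt by (simp add: contracting_def algebra_simps)
    moreover have "boundary (Co ?t) = boundary ?s - boundary (Co ?r)"
      by (simp only: Co_ys linear_diff[OF linear_boundary])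
    ultimately show ?thesis by simp
  qed
  ultimately have t_in: "?t \<in> contracting X a Co l"
    using T[OF t] by (simp add: contracting_def)
  have "Poly_Mapping.lookup (boundary ?s) ys \<in> {1, -1}"
    by (rule lookup_boundary_face[OF d ne c'(3,5)])
  \<comment> \<open>The incidence coefficient is its own inverse, so multiplying by it again undoes
    the reorientation.\<close>
  then have "oriented_simplex ys = Poly_Mapping.lookup (boundary ?s) ys *\<^sub>R ?t"
    by (auto simp: induced_face_def)
  then have y_in: "oriented_simplex ys \<in> contracting X a Co l"
    using subspace_scale[OF W t_in] by metis
  show ?thesis
  proof (rule chains_subset_subspace[OF W])
    fix zs assume zs: "distinct zs" "set zs \<in> simplices Y k"
    then have k: "length zs = Suc k" by (simp add: simplices_def distinct_card)
    consider "set zs = set xs" | "set zs = set ys" | "set zs \<in> Y'"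
      using zs(2) c'(6) by (auto simp: simplices_def)
    then show "oriented_simplex zs \<in> contracting X a Co k"
    proof cases
      case 1
      then have "k = Suc l" using k zs(1) d(1) c'(4) l by (metis distinct_card nat.inject)
      then show ?thesis using contracting_reorder[OF W s_in zs(1) d(1) 1] by simp
    next
      case 2
      then have "k = l" using k zs(1) d(2) l by (metis distinct_card nat.inject)
      then show ?thesis using contracting_reorder[OF W y_in zs(1) d(2) 2] by simp
    next
      case 3
      then have "set zs \<in> simplices Y' k" using zs(2) by (simp add: simplices_def)
      then show ?thesis using IH oriented_simplex_in_chains zs(1) by blast
    qed
  qed
qed

section \<open>Induction along the collapse sequence\<close>

theorem proposition4p4:
  fixes X :: "'v set set"
    and Xs :: "nat \<Rightarrow> 'v set set"
    and m :: nat
    and \<sigma> \<tau> :: "nat \<Rightarrow> 'v list"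
    and a :: 'v
    and Co :: "'v chain \<Rightarrow> 'v chain"
  assumes "abstract_simplicial_complex X"
    and "collapse_sequence X m Xs \<sigma> \<tau> a"
    and "linear_map_between (total_chains X) (total_chains X) Co"
    and "Co (oriented_simplex [a]) = 0"
    and "\<And>j. j \<in> {1..m} \<Longrightarrow> Co (oriented_simplex (\<sigma> j)) = 0"
    and "\<And>j. j \<in> {1..m} \<Longrightarrow>
           Co (induced_face (\<sigma> j) (\<tau> j)) =
             oriented_simplex (\<sigma> j)
               - Co (boundary (oriented_simplex (\<sigma> j)) - induced_face (\<sigma> j) (\<tau> j))"
  shows "simplicial_cone_operator X a Co"
proof -
  note X = assms(1) and Co = assms(3)
  have ends: "Xs m = X" "Xs 0 = {{a}}"
    and dist: "\<And>j. j < m \<Longrightarrow> distinct (\<sigma> (Suc j)) \<and> distinct (\<tau> (Suc j))"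
    and coll: "\<And>j. j < m \<Longrightarrow>
      elementary_collapse (Xs (Suc j)) (set (\<sigma> (Suc j))) (set (\<tau> (Suc j))) (Xs j)"
    using assms(2) unfolding collapse_sequence_def by (auto dest!: bspec[of _ _ "Suc _"])
  \<comment> \<open>This induction descends from X, because a collapse passes the complex property
    on to the smaller complex; the one for the cone identity ascends from the vertex.\<close>
  have cplx: "abstract_simplicial_complex (Xs j) \<and> Xs j \<subseteq> X" if "j \<le> m" for j
    using that
  proof (induction rule: inc_induct)
    case base
    then show ?case using X ends by simp
  next
    case (step n)
    moreover have "Xs n \<subseteq> Xs (Suc n)"
      using coll[OF step.hyps(2)] by (auto simp: elementary_collapse_def)
    ultimately show ?case using abstract_simplicial_complex_collapse coll by blast
  qed
  have a: "{a} \<in> X" using cplx[of 0] ends by simp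
  note W = subspace_contracting[OF X a Co]
  have "chains (Xs j) k \<subseteq> contracting X a Co k" if "j \<le> m" for j k
    using that
  proof (induction j arbitrary: k)
    \<comment> \<open>For the single vertex both terms with \<open>Co\<close> vanish, and so does a
      - \<epsilon>(a)a.\<close>
    case 0
    show ?case
    proof (rule chains_subset_subspace[OF W])
      fix xs assume xs: "distinct xs" "set xs \<in> simplices (Xs 0) k"
      then have set: "set xs = {a}" by (simp add: simplices_def ends)
      then have "length xs = 1" using distinct_card[OF xs(1)] by simp
      then have "xs = [a]" using set by (cases xs) auto
      moreover have "Co 0 = 0"
        by (rule linear_map_between_0[OF Co subspace_total_chains])
      moreover have "oriented_simplex [a] \<in> total_chains X"
        using oriented_simplex_in_chains[of "[a]" X 0] chains_subset_total_chains a
        by (auto simp: simplices_def)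
      ultimately show "oriented_simplex xs \<in> contracting X a Co k"
        using assms(4) by (simp add: contracting_def boundary_oriented_simplex simplex_boundary_def
            linear_0[OF linear_boundary] subspace_0[OF subspace_chains]
            augmentation_oriented_simplex_vertex)
    qed
  next
    case (Suc j)
    then have j: "j < m" "Suc j \<in> {1..m}" by auto
    show ?case
      using cplx[OF Suc.prems] dist[OF j(1)] Suc.IH j(1)
      by (intro contracting_collapse[OF X a Co _ _ coll[OF j(1)] _ _ assms(5)[OF j(2)] assms(6)[OF j(2)]])
        auto
  qed
  from this[OF order_refl] have main: "chains X k \<subseteq> contracting X a Co k" for k
    by (simp add: ends)
  show ?thesis
    unfolding simplicial_cone_operator_def
  proof (intro conjI allI impI ballI)
    show "{a} \<in> simplices X 0" using a by (simp add: simplices_def)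
    show "linear_map_between (total_chains X) (total_chains X) Co" by (rule Co)
    show "Co c \<in> chains X (k + 1)" if "c \<in> chains X k" for k c
      using main that by (auto simp: contracting_def)
  next
    \<comment> \<open>For k at least 1 the augmentation term vanishes.\<close>
    fix k :: nat and xs
    assume k: "1 \<le> k" and xs: "distinct xs \<and> set xs \<in> simplices X k"
    then have "length xs \<noteq> 1" by (auto simp: simplices_def distinct_card)
    moreover have "oriented_simplex xs \<in> contracting X a Co k"
      using main oriented_simplex_in_chains xs by blast
    ultimately show "Co (boundary (oriented_simplex xs)) + boundary (Co (oriented_simplex xs))
        = oriented_simplex xs"
      by (simp add: contracting_def augmentation_oriented_simplex_long)
  next
    \<comment> \<open>For a vertex \<partial>v = 0 and \<epsilon>(v) = 1, so the same identity reads
      \<partial>Co(v) = v - a.\<close>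
    fix v assume "{v} \<in> simplices X 0"
    then have "oriented_simplex [v] \<in> contracting X a Co 0"
      using main oriented_simplex_in_chains[of "[v]" X 0] by auto
    moreover have "Co 0 = 0"
      by (rule linear_map_between_0[OF Co subspace_total_chains])
    ultimately show "boundary (Co (oriented_simplex [v])) = oriented_simplex [v] - oriented_simplex [a]"
      by (simp add: contracting_def boundary_oriented_simplex simplex_boundary_def
          augmentation_oriented_simplex_vertex)
  qed
qed

end
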